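(* Let $\mathcal M=(X,P)$ be a mechanism, let $\mathcal I$ be a class of instances for $\mathcal M$, let $\mathcal I^\infty\subseteq\mathcal I$ be its subclass of budget-free instances, and let $\lambda>0$, $\mu\ge 0$. Suppose that for every instance $I\in\mathcal I$ there exist threshold functions $(T_i)_{i\in N}$, $T_i:\mathcal X_i\times\mathcal A_{-i}\to\mathbb R_{\ge0}$, such that (i) for every NOB-feasible coarse correlated equilibrium $A$ of $I$ and every optimal liquid welfare profile $\chi^*$, $$\sum_{i\in N}\mathbb E_{x_i\sim\chi_i^*,\,a_{-i}\sim A_{-i}}[T_i(x_i,a_{-i})]\le\sum_{i\in N}\mathbb E_{a\sim A}[W_i(a)],$$ and (ii) every bidder of $I$ is budget-feasible $(\lambda,\mu)$-semi-smooth with respect to these threshold functions. Let $\mathbb 1_{\{\mathcal I\ne\mathcal I^\infty\}}$ be $1$ if $\mathcal I\neq\mathcal I^\infty$ and $0$ otherwise. Then: (a) If $\mathcal M$ is pay-your-bid, then the price of anarchy satisfies $$\text{CCE-POA}(\mathcal I)\le\frac{\max\{1,\ \mu+\lambda\,\mathbb 1_{\{\mathcal I\ne\mathcal I^\infty\}}\}}{\lambda}.$$ (b) For an arbitrary mechanism $\mathcal M$ (with the price of anarchy taken over NOB-feasible coarse correlated equilibria), $$\text{CCE-POA}(\mathcal I)\le\frac{\mu+\max\{1,\ \lambda\,\mathbb 1_{\{\mathcal I\ne\mathcal I^\infty\}}\}}{\lambda}.$$ Here a bound $\text{CCE-POA}(\mathcal I)\le c$ means $\mathrm{OPT}(I)\le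 c\cdot\mathrm{LW}(I,A)$ for every $I\in\mathcal I$ and every NOB-feasible coarse correlated equilibrium $A$ of $I$.
   Context: An instance $I$ consists of bidders $N=[n]$, $n\ge2$, where bidder $i$ has an action set $\mathcal A_i$, a finite set of allocations $\mathcal X_i$, a valuation $v_i:\mathcal X_i\to\mathbb R_{\ge0}$ and a budget $B_i\in(0,\infty]$; $\mathcal A=\prod_i\mathcal A_i$, and $\mathcal X\subseteq\prod_i\mathcal X_i$ is the set of feasible allocation profiles. The instance is budget-free if $B_i=\infty$ for all $i$. A mechanism $\mathcal M=(X,P)$ consists of $X:\mathcal A\to\mathcal X$ and $P:\mathcal A\to\mathbb R_{\ge0}^n$, with components $X_i,P_i$. Each bidder has an opt-out action $\emptyset_i\in\mathcal A_i$ with $P_i(\emptyset_i,a_{-i})=0$ for all $a_{-i}$. Utility: $u_i(a)=v_i(X_i(a))-P_i(a)$. $\Delta(S)$ is the set of probability distributions on $S$. For $A\in\Delta(\mathcal A)$, $A_{-i}$ is the marginal on the other bidders' actions. $\mathcal C_i(A_{-i})$ is the set of $A_i'\in\Delta(\mathcal A_i)$ with $\mathbb E_{a_i'\sim A_i',\,a_{-i}\sim A_{-i}}[P_i(a_i',a_{-i})]\le B_i$ (independent draws). $A$ is budget-feasible if $\mathbb E_{a\sim A}[P_i(a)]\le B_i$ for all $i$. A budget-feasible $A\in\Delta(\mathcal A)$ is a coarse correlated equilibrium (CCE) if for all $i$ and all $A_i'\in\mathcal C_i(A_{-i})$: $\mathbb E_{a\sim A}[u_i(a)]\ge\mathbb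 E_{a_i'\sim A_i',a_{-i}\sim A_{-i}}[u_i(a_i',a_{-i})]$. Liquid welfare: $\mathrm{LW}(I,A)=\sum_i\min\{\mathbb E_{a\sim A}[v_i(X_i(a))],B_i\}$. For $\chi\in\Delta(\mathcal X)$ with marginals $\chi_i$, $\hat v_i(\chi_i)=\min\{\mathbb E_{x_i\sim\chi_i}[v_i(x_i)],B_i\}$ and $\mathrm{OPT}(I)=\max_{\chi\in\Delta(\mathcal X)}\sum_i\hat v_i(\chi_i)$; a maximizer $\chi^*$ is called an optimal liquid welfare profile. Willingness to pay: $W_i(a_i,x_i)=\sup\{P_i(a_i,a_{-i}) : a_{-i}\text{ with }X_i(a_i,a_{-i})=x_i\}$ and $W_i(a)=W_i(a_i,X_i(a))$. $\mathcal M$ is pay-your-bid if $P_i(a)=W_i(a)$ for all $a,i$. $A$ is NOB-feasible (no overbidding) if $\sum_i\mathbb E_{a\sim A}[W_i(a)]\le\mathrm{LW}(I,A)$. Only NOB-feasible CCE are considered (for pay-your-bid mechanisms every CCE is NOB-feasible). $\text{CCE-POA}(\mathcal I)=\sup_{I\in\mathcal I}\sup_A\mathrm{OPT}(I)/\mathrm{LW}(I,A)$, over NOB-feasible CCE $A$ of $I$. Given threshold functions and an optimal liquid welfare profile $\chi^*$, bidder $i$ is budget-feasible $(\lambda,\mu)$-semi-smooth if for every (NOB-feasible) CCE $A$ there is $A_i'\in\mathcal C_i(A_{-i})$ with $$\mathbb E_{a_i'\sim A_i',a_{-i}\sim A_{-i}}[u_i(a_i',a_{-i})]\ge\lambda\hat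 v_i(\chi_i^* )-\mu\,\mathbb E_{x_i\sim\chi_i^*,a_{-i}\sim A_{-i}}[T_i(x_i,a_{-i})].$$ *)

theory Defs
  imports "HOL-Probability.Probability"
begin

text \<open>
  Action sets may be infinite, so each one is a measurable space (only \<open>space\<close> and \<open>sets\<close>
  of the measure \<open>actions I i\<close> are ever used), and \<open>\<Delta>(\<A>)\<close> is the set of all probability
  measures on the product space.  Allocation sets are finite, so distributions on \<open>\<X>\<close> are
  given as \<open>pmf\<close>s.  Profiles are extensional functions on the index set \<open>{1..n}\<close>; profiles
  of the other bidders are extensional on \<open>{1..n} - {i}\<close>.  Budgets, willingness to pay,
  welfare and expected payments are extended nonnegative reals.
\<close>

record ('a, 'x) auction_instance =
  num_bidders :: nat
  actions :: "nat \<Rightarrow> 'a measure"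
  allocs :: "nat \<Rightarrow> 'x set"
  feasible :: "(nat \<Rightarrow> 'x) set"
  valuation :: "nat \<Rightarrow> 'x \<Rightarrow> real"
  budget :: "nat \<Rightarrow> ennreal"

record ('a, 'x) mechanism =
  alloc :: "(nat \<Rightarrow> 'a) \<Rightarrow> nat \<Rightarrow> 'x"
  pay :: "(nat \<Rightarrow> 'a) \<Rightarrow> nat \<Rightarrow> real"

definition bidders :: "('a, 'x) auction_instance \<Rightarrow> nat set" where
  "bidders I = {1..num_bidders I}"

definition profiles :: "('a, 'x) auction_instance \<Rightarrow> (nat \<Rightarrow> 'a) measure" where
  "profiles I = PiM (bidders I) (actions I)"

definition others :: "('a, 'x) auction_instance \<Rightarrow> nat \<Rightarrow> (nat \<Rightarrow> 'a) measure" where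
  "others I i = PiM (bidders I - {i}) (actions I)"

definition valid_instance :: "('a, 'x) auction_instance \<Rightarrow> bool" where
  "valid_instance I \<longleftrightarrow>
     num_bidders I \<ge> 2 \<and>
     (\<forall>i\<in>bidders I. finite (allocs I i)) \<and>
     feasible I \<subseteq> PiE (bidders I) (allocs I) \<and>
     (\<forall>i\<in>bidders I. \<forall>x\<in>allocs I i. valuation I i x \<ge> 0) \<and>
     (\<forall>i\<in>bidders I. budget I i > 0)"

definition budget_free :: "('a, 'x) auction_instance \<Rightarrow> bool" where
  "budget_free I \<longleftrightarrow> (\<forall>i\<in>bidders I. budget I i = \<infinity>)"

text \<open>
  \<open>(X, P)\<close> is a mechanism on the action and allocation sets of \<open>I\<close>.  The last conjunct is
  the existence of the opt-out actions.
\<close>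

definition mechanism_for :: "('a, 'x) mechanism \<Rightarrow> ('a, 'x) auction_instance \<Rightarrow> bool" where
  "mechanism_for M I \<longleftrightarrow>
     (\<forall>a\<in>space (profiles I). alloc M a \<in> feasible I) \<and>
     (\<forall>i\<in>bidders I. (\<lambda>a. alloc M a i) \<in> measurable (profiles I) (count_space (allocs I i))) \<and>
     (\<forall>i\<in>bidders I. \<forall>a\<in>space (profiles I). pay M a i \<ge> 0) \<and>
     (\<forall>i\<in>bidders I. (\<lambda>a. pay M a i) \<in> borel_measurable (profiles I)) \<and>
     (\<forall>i\<in>bidders I. \<exists>e\<in>space (actions I i). \<forall>b\<in>space (others I i). pay M (b(i := e)) i = 0)"

definition utility ::
    "('a, 'x) mechanism \<Rightarrow> ('a, 'x) auction_instance \<Rightarrow> nat \<Rightarrow> (nat \<Rightarrow> 'a) \<Rightarrow> real" where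
  "utility M I i a = valuation I i (alloc M a i) - pay M a i"

definition distributions :: "'b measure \<Rightarrow> 'b measure set" where
  "distributions S = {D. prob_space D \<and> sets D = sets S}"

text \<open>
  Expectation of a function whose positive part has finite expectation, as is the case for
  utilities, which are bounded above; the value \<open>-\<infinity>\<close> is possible because payments may be
  unbounded.  Note that \<open>ennreal\<close> maps negative reals to \<open>0\<close>, so the two terms are the
  integrals of the positive and the negative part.
\<close>

definition expect :: "'b measure \<Rightarrow> ('b \<Rightarrow> real) \<Rightarrow> ereal" where
  "expect D f = enn2ereal (\<integral>\<^sup>+ z. ennreal (f z) \<partial>D) - enn2ereal (\<integral>\<^sup>+ z. ennreal (- f z) \<partial>D)"

definition marginal_others ::
    "('a, 'x) auction_instance \<Rightarrow> nat \<Rightarrow> (nat \<Rightarrow> 'a) measure \<Rightarrow> (nat \<Rightarrow> 'a) measure" where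
  "marginal_others I i A = distr A (others I i) (\<lambda>a. restrict a (bidders I - {i}))"

text \<open>
  \<open>deviations M I i R\<close> is \<open>\<C>\<^sub>i(R)\<close> for a distribution \<open>R\<close> of the others' actions.
\<close>

definition deviations ::
    "('a, 'x) mechanism \<Rightarrow> ('a, 'x) auction_instance \<Rightarrow> nat \<Rightarrow> (nat \<Rightarrow> 'a) measure \<Rightarrow> 'a measure set" where
  "deviations M I i R =
     {D \<in> distributions (actions I i).
        (\<integral>\<^sup>+ (a', b). ennreal (pay M (b(i := a')) i) \<partial>(D \<Otimes>\<^sub>M R)) \<le> budget I i}"

definition deviation_utility ::
    "('a, 'x) mechanism \<Rightarrow> ('a, 'x) auction_instance \<Rightarrow> nat \<Rightarrow> 'a measure \<Rightarrow> (nat \<Rightarrow> 'a) measure \<Rightarrow> ereal" where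
  "deviation_utility M I i D R = expect (D \<Otimes>\<^sub>M R) (\<lambda>(a', b). utility M I i (b(i := a')))"

definition budget_feasible ::
    "('a, 'x) mechanism \<Rightarrow> ('a, 'x) auction_instance \<Rightarrow> (nat \<Rightarrow> 'a) measure \<Rightarrow> bool" where
  "budget_feasible M I A \<longleftrightarrow>
     (\<forall>i\<in>bidders I. (\<integral>\<^sup>+ a. ennreal (pay M a i) \<partial>A) \<le> budget I i)"

definition is_CCE ::
    "('a, 'x) mechanism \<Rightarrow> ('a, 'x) auction_instance \<Rightarrow> (nat \<Rightarrow> 'a) measure \<Rightarrow> bool" where
  "is_CCE M I A \<longleftrightarrow>
     A \<in> distributions (profiles I) \<and> budget_feasible M I A \<and>
     (\<forall>i\<in>bidders I. \<forall>D\<in>deviations M I i (marginal_others I i A).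
        expect A (utility M I i) \<ge> deviation_utility M I i D (marginal_others I i A))"

definition liquid_welfare ::
    "('a, 'x) mechanism \<Rightarrow> ('a, 'x) auction_instance \<Rightarrow> (nat \<Rightarrow> 'a) measure \<Rightarrow> ennreal" where
  "liquid_welfare M I A =
     (\<Sum>i\<in>bidders I. min (\<integral>\<^sup>+ a. ennreal (valuation I i (alloc M a i)) \<partial>A) (budget I i))"

definition vhat :: "('a, 'x) auction_instance \<Rightarrow> nat \<Rightarrow> 'x pmf \<Rightarrow> ennreal" where
  "vhat I i p = min (\<integral>\<^sup>+ x. ennreal (valuation I i x) \<partial>measure_pmf p) (budget I i)"

definition marginal_alloc :: "nat \<Rightarrow> (nat \<Rightarrow> 'x) pmf \<Rightarrow> 'x pmf" where
  "marginal_alloc i q = map_pmf (\<lambda>x. x i) q"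

definition allocation_welfare :: "('a, 'x) auction_instance \<Rightarrow> (nat \<Rightarrow> 'x) pmf \<Rightarrow> ennreal" where
  "allocation_welfare I q = (\<Sum>i\<in>bidders I. vhat I i (marginal_alloc i q))"

definition OPT :: "('a, 'x) auction_instance \<Rightarrow> ennreal" where
  "OPT I = (SUP q\<in>{q. set_pmf q \<subseteq> feasible I}. allocation_welfare I q)"

definition optimal_profile :: "('a, 'x) auction_instance \<Rightarrow> (nat \<Rightarrow> 'x) pmf \<Rightarrow> bool" where
  "optimal_profile I q \<longleftrightarrow> set_pmf q \<subseteq> feasible I \<and> allocation_welfare I q = OPT I"

text \<open>The supremum in \<open>OPT\<close> is a maximum.\<close>

lemma optimal_profile_exists:
  fixes I :: "('a, 'x) auction_instance"
  assumes "valid_instance I" "feasible I \<noteq> {}"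
  shows "\<exists>q. optimal_profile I q"
proof -
  define F where "F = feasible I"
  have sub: "F \<subseteq> PiE (bidders I) (allocs I)"
    and nn: "\<And>i x. i \<in> bidders I \<Longrightarrow> x \<in> allocs I i \<Longrightarrow> valuation I i x \<ge> 0"
    and finA: "\<And>i. i \<in> bidders I \<Longrightarrow> finite (allocs I i)"
    using assms(1) by (auto simp: valid_instance_def F_def)
  have fin: "finite F"
    by (rule finite_subset[OF sub], rule finite_PiE) (auto simp: bidders_def finA)
  have vnn: "valuation I i (x i) \<ge> 0" if "i \<in> bidders I" "x \<in> F" for i x
    using that sub nn by blast
  define S where "S = (PiE UNIV (\<lambda>x. if x \<in> F then {0..1::real} else {0})) \<inter> {p. (\<Sum>x\<in>F. p x) = 1}"
  define g where "g p = (\<Sum>i\<in>bidders I. min (ennreal (\<Sum>x\<in>F. p x * valuation I i (x i))) (budget I i))"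
    for p :: "(nat \<Rightarrow> 'x) \<Rightarrow> real"
  have co: "continuous_on UNIV (\<lambda>p :: (nat \<Rightarrow> 'x) \<Rightarrow> real. p x)" for x
    by (rule continuous_on_product_coordinates)
  have cS: "compact S"
    unfolding S_def
  proof (rule compact_Int_closed)
    show "closed {p :: (nat \<Rightarrow> 'x) \<Rightarrow> real. (\<Sum>x\<in>F. p x) = 1}"
      by (intro closed_Collect_eq continuous_on_sum co continuous_on_const)
    have "compactin (product_topology (\<lambda>_. euclidean) UNIV)
            (PiE UNIV (\<lambda>x. if x \<in> F then {0..1::real} else {0}))"
      by (subst compactin_PiE) auto
    then show "compact (PiE UNIV (\<lambda>x. if x \<in> F then {0..1::real} else {0}))"
      by (simp add: euclidean_product_topology)
  qed
  have gcont: "continuous_on S g"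
    unfolding g_def
    by (intro continuous_on_sum continuous_on_min continuous_on_ennreal continuous_on_mult
          continuous_on_const continuous_on_subset[OF co]) auto
  have val: "allocation_welfare I q = g (pmf q)" if "set_pmf q \<subseteq> F" for q
  proof -
    have "(\<integral>\<^sup>+ x. ennreal (valuation I i x) \<partial>measure_pmf (marginal_alloc i q))
        = ennreal (\<Sum>x\<in>F. pmf q x * valuation I i (x i))" if i: "i \<in> bidders I" for i
    proof -
      have "(\<integral>\<^sup>+ x. ennreal (valuation I i x) \<partial>measure_pmf (marginal_alloc i q))
          = (\<integral>\<^sup>+ x. ennreal (valuation I i (x i)) \<partial>measure_pmf q)"
        by (simp add: marginal_alloc_def)
      also have "\<dots> = (\<Sum>x\<in>F. ennreal (valuation I i (x i)) * pmf q x)"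
        using fin \<open>set_pmf q \<subseteq> F\<close> by (intro nn_integral_measure_pmf_support) auto
      also have "\<dots> = (\<Sum>x\<in>F. ennreal (pmf q x * valuation I i (x i)))"
        using vnn[OF i] by (intro sum.cong) (auto simp: ennreal_mult mult.commute)
      also have "\<dots> = ennreal (\<Sum>x\<in>F. pmf q x * valuation I i (x i))"
        using vnn[OF i] by (intro sum_ennreal) auto
      finally show ?thesis .
    qed
    then show ?thesis
      unfolding allocation_welfare_def vhat_def g_def by (intro sum.cong) auto
  qed
  have inS: "pmf q \<in> S" if "set_pmf q \<subseteq> F" for q
    using that fin by (auto simp: S_def PiE_def Pi_def pmf_le_1 sum_pmf_eq_1 set_pmf_iff)
  have toq: "\<exists>q. set_pmf q \<subseteq> F \<and> pmf q = p" if p: "p \<in> S" for p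
  proof -
    have p0: "p x \<ge> 0" for x
      using p by (cases "x \<in> F") (auto simp: S_def PiE_def Pi_def dest!: spec[of _ x])
    have pz: "p x = 0" if "x \<notin> F" for x
      using p that by (auto simp: S_def PiE_def Pi_def dest!: spec[of _ x])
    have "(\<integral>\<^sup>+ x. ennreal (p x) \<partial>count_space UNIV) = (\<Sum>x\<in>F. ennreal (p x))"
      using fin pz by (intro nn_integral_count_space'[of F]) auto
    also have "\<dots> = ennreal (\<Sum>x\<in>F. p x)"
      using p0 by (intro sum_ennreal) auto
    also have "\<dots> = 1" using p by (simp add: S_def)
    finally have "pmf (embed_pmf p) x = p x" for x
      using p0 by (intro pmf_embed_pmf) auto
    then have "pmf (embed_pmf p) = p" by blast
    moreover from this have "set_pmf (embed_pmf p) \<subseteq> F"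
      using pz by (metis set_pmf_iff subsetI)
    ultimately show ?thesis by blast
  qed
  obtain x0 where "x0 \<in> F" using assms(2) by (auto simp: F_def)
  then have "pmf (return_pmf x0) \<in> S" by (intro inS) auto
  then obtain p where p: "p \<in> S" "\<And>p'. p' \<in> S \<Longrightarrow> g p' \<le> g p"
    using continuous_attains_sup[OF cS _ gcont] by blast
  obtain q where q: "set_pmf q \<subseteq> F" "pmf q = p" using toq[OF p(1)] by blast
  have "OPT I \<le> allocation_welfare I q"
    unfolding OPT_def using val inS q p(2) by (intro SUP_least) (auto simp: F_def)
  moreover have "allocation_welfare I q \<le> OPT I"
    unfolding OPT_def using q(1) by (intro SUP_upper) (auto simp: F_def)
  ultimately show ?thesis
    using q(1) by (auto simp: optimal_profile_def F_def)
qed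

text \<open>
  \<open>willingness M I i a\<^sub>i x\<^sub>i\<close> is \<open>W\<^sub>i(a\<^sub>i, x\<^sub>i)\<close>, and \<open>willingness_at M I i a\<close> is \<open>W\<^sub>i(a)\<close>.
  As a supremum over a possibly uncountable set, \<open>W\<^sub>i\<close> need not be measurable for the
  product \<open>\<sigma>\<close>-algebra.  The nonnegative integral is total (a lower integral) and agrees with
  that of the completed measure, hence is the expectation whenever \<open>W\<^sub>i\<close> is measurable for
  the completion, e.g. if it is universally measurable.  The same applies to the
  threshold functions \<open>T\<^sub>i\<close> below.
\<close>

definition willingness ::
    "('a, 'x) mechanism \<Rightarrow> ('a, 'x) auction_instance \<Rightarrow> nat \<Rightarrow> 'a \<Rightarrow> 'x \<Rightarrow> ennreal" where
  "willingness M I i ai xi =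
     (SUP b\<in>{b \<in> space (others I i). alloc M (b(i := ai)) i = xi}. ennreal (pay M (b(i := ai)) i))"

definition willingness_at ::
    "('a, 'x) mechanism \<Rightarrow> ('a, 'x) auction_instance \<Rightarrow> nat \<Rightarrow> (nat \<Rightarrow> 'a) \<Rightarrow> ennreal" where
  "willingness_at M I i a = willingness M I i (a i) (alloc M a i)"

definition pay_your_bid :: "('a, 'x) mechanism \<Rightarrow> ('a, 'x) auction_instance \<Rightarrow> bool" where
  "pay_your_bid M I \<longleftrightarrow>
     (\<forall>a\<in>space (profiles I). \<forall>i\<in>bidders I. ennreal (pay M a i) = willingness_at M I i a)"

definition NOB_feasible ::
    "('a, 'x) mechanism \<Rightarrow> ('a, 'x) auction_instance \<Rightarrow> (nat \<Rightarrow> 'a) measure \<Rightarrow> bool" where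
  "NOB_feasible M I A \<longleftrightarrow>
     (\<Sum>i\<in>bidders I. \<integral>\<^sup>+ a. willingness_at M I i a \<partial>A) \<le> liquid_welfare M I A"

definition NOB_CCE ::
    "('a, 'x) mechanism \<Rightarrow> ('a, 'x) auction_instance \<Rightarrow> (nat \<Rightarrow> 'a) measure \<Rightarrow> bool" where
  "NOB_CCE M I A \<longleftrightarrow> is_CCE M I A \<and> NOB_feasible M I A"

definition budget_free_part ::
    "('a, 'x) auction_instance set \<Rightarrow> ('a, 'x) auction_instance set" where
  "budget_free_part \<I> = {I \<in> \<I>. budget_free I}"

text \<open>A bound \<open>c\<close> on the price of anarchy, in multiplicative form since welfare may vanish.\<close>

definition CCE_POA_le ::
    "('a, 'x) mechanism \<Rightarrow> ('a, 'x) auction_instance set \<Rightarrow> real \<Rightarrow> bool" where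
  "CCE_POA_le M \<I> c \<longleftrightarrow>
     (\<forall>I\<in>\<I>. \<forall>A. NOB_CCE M I A \<longrightarrow> OPT I \<le> ennreal c * liquid_welfare M I A)"

definition threshold_functions ::
    "('a, 'x) auction_instance \<Rightarrow> (nat \<Rightarrow> 'x \<Rightarrow> (nat \<Rightarrow> 'a) \<Rightarrow> real) \<Rightarrow> bool" where
  "threshold_functions I T \<longleftrightarrow>
     (\<forall>i\<in>bidders I. \<forall>x\<in>allocs I i. \<forall>b\<in>space (others I i). T i x b \<ge> 0)"

definition expected_threshold ::
    "('a, 'x) auction_instance \<Rightarrow> (nat \<Rightarrow> 'x \<Rightarrow> (nat \<Rightarrow> 'a) \<Rightarrow> real) \<Rightarrow> nat \<Rightarrow>
     (nat \<Rightarrow> 'x) pmf \<Rightarrow> (nat \<Rightarrow> 'a) measure \<Rightarrow> ennreal" where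
  "expected_threshold I T i q A =
     (\<integral>\<^sup>+ (x, b). ennreal (T i x b) \<partial>(measure_pmf (marginal_alloc i q) \<Otimes>\<^sub>M marginal_others I i A))"

definition semi_smooth ::
    "('a, 'x) mechanism \<Rightarrow> ('a, 'x) auction_instance \<Rightarrow> (nat \<Rightarrow> 'x \<Rightarrow> (nat \<Rightarrow> 'a) \<Rightarrow> real) \<Rightarrow>
     (nat \<Rightarrow> 'x) pmf \<Rightarrow> real \<Rightarrow> real \<Rightarrow> nat \<Rightarrow> bool" where
  "semi_smooth M I T q lam mu i \<longleftrightarrow>
     (\<forall>A. NOB_CCE M I A \<longrightarrow>
       (\<exists>D\<in>deviations M I i (marginal_others I i A).
          deviation_utility M I i D (marginal_others I i A) \<ge>
            ereal lam * enn2ereal (vhat I i (marginal_alloc i q))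
            - ereal mu * enn2ereal (expected_threshold I T i q A)))"

end

theory Submission
  imports Defs
begin

text \<open>
  Call bidder \<open>i\<close> saturated if her expected value exceeds her budget, so that her liquid
  welfare is \<open>B\<^sub>i\<close>.  A saturated bidder satisfies \<open>\<lambda> v\<^sub>i(\<chi>*) \<le> \<lambda> B\<^sub>i\<close> trivially and pays at most
  \<open>B\<^sub>i\<close>; for an unsaturated bidder, the equilibrium condition against the smooth deviation gives
  \<open>\<lambda> v\<^sub>i(\<chi>*) + P\<^sub>i \<le> LW\<^sub>i + \<mu> T\<^sub>i\<close>.  Summing over all bidders, the thresholds are absorbed by the
  willingness to pay, hence by the welfare.  In the pay-your-bid case they are absorbed by the
  payments, and only the excess of \<open>\<mu>\<close> over \<open>1\<close> is charged to the welfare.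
\<close>

section \<open>Expectations and inequalities with possibly infinite terms\<close>

text \<open>Integrating the pointwise identity \<open>f + (f - g)^- = (f - g)^+ + g\<close> relates
  four nonnegative integrals. Those of \<open>f\<close> and of the positive part are finite, so they
  can be moved across even when \<open>g\<close> has infinite integral.\<close>

lemma expect_diff:
  fixes f g :: "'b \<Rightarrow> real"
  assumes f: "f \<in> borel_measurable D" "\<And>z. z \<in> space D \<Longrightarrow> 0 \<le> f z"
    and g: "g \<in> borel_measurable D" "\<And>z. z \<in> space D \<Longrightarrow> 0 \<le> g z"
    and fin: "(\<integral>\<^sup>+ z. ennreal (f z) \<partial>D) < \<infinity>"
  shows "expect D (\<lambda>z. f z - g z)
    = enn2ereal (\<integral>\<^sup>+ z. ennreal (f z) \<partial>D) - enn2ereal (\<integral>\<^sup>+ z. ennreal (g z) \<partial>D)"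
proof -
  define F where "F = (\<integral>\<^sup>+ z. ennreal (f z) \<partial>D)"
  define G where "G = (\<integral>\<^sup>+ z. ennreal (g z) \<partial>D)"
  define U where "U = (\<integral>\<^sup>+ z. ennreal (f z - g z) \<partial>D)"
  define N where "N = (\<integral>\<^sup>+ z. ennreal (- (f z - g z)) \<partial>D)"
  have [measurable]: "f \<in> borel_measurable D" "g \<in> borel_measurable D"
    using f g by auto
  have "F + N = (\<integral>\<^sup>+ z. ennreal (f z) + ennreal (- (f z - g z)) \<partial>D)"
    unfolding F_def N_def by (intro nn_integral_add[symmetric]) auto
  also have "\<dots> = (\<integral>\<^sup>+ z. ennreal (f z - g z) + ennreal (g z) \<partial>D)"
  proof (intro nn_integral_cong)
    fix z assume z: "z \<in> space D"
    show "ennreal (f z) + ennreal (- (f z - g z)) = ennreal (f z - g z) + ennreal (g z)"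
      using f(2)[OF z] g(2)[OF z]
      by (cases "f z \<le> g z") (auto simp: ennreal_neg simp flip: ennreal_plus)
  qed
  also have "\<dots> = U + G"
    unfolding U_def G_def by (intro nn_integral_add) auto
  finally have eq: "F + N = U + G" .
  have le: "U \<le> F"
    unfolding U_def F_def by (intro nn_integral_mono ennreal_leI) (use g(2) in auto)
  obtain x where x: "F = ennreal x" "x \<ge> 0" using fin by (cases F) (auto simp: F_def)
  obtain y where y: "U = ennreal y" "y \<ge> 0" using x le by (cases U) (auto simp: top_unique)
  have "enn2ereal U - enn2ereal N = enn2ereal F - enn2ereal G"
  proof (cases N)
    case (real r)
    then obtain s where "G = ennreal s" "s \<ge> 0"
      using eq x y by (cases G) (auto simp flip: ennreal_plus)
    then show ?thesis
      using eq real x y by (simp add: enn2ereal_ennreal flip: ennreal_plus)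
  next
    \<comment> \<open>An infinite negative part forces the integral of \<open>g\<close> to be
      infinite, and both differences are -infinity.\<close>
    case top
    then have "G = \<top>" using eq y by (cases G) (auto simp flip: ennreal_plus)
    then show ?thesis using top x y by (simp add: enn2ereal_ennreal top_ennreal.rep_eq)
  qed
  then show ?thesis
    by (simp add: expect_def F_def G_def U_def N_def)
qed

text \<open>Finite \<open>T\<close> and \<open>V\<close> exclude infinity minus infinity. The left
  side is then above -infinity, which forces \<open>P\<close> to be finite; the right side is then
  finite, which forces \<open>v\<close> to be finite since \<open>lam > 0\<close>. What remains is a
  rearrangement of reals.\<close>

lemma ereal_smoothness_to_ennreal:
  fixes v V P T :: ennreal
  assumes "ereal lam * enn2ereal v - ereal mu * enn2ereal T \<le> enn2ereal V - enn2ereal P"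
    and "lam > 0" "mu \<ge> 0" "T < \<infinity>" "V < \<infinity>"
  shows "ennreal lam * v + P \<le> V + ennreal mu * T"
proof -
  obtain t where t: "T = ennreal t" "t \<ge> 0" using assms by (cases T) auto
  obtain u where u: "V = ennreal u" "u \<ge> 0" using assms by (cases V) auto
  obtain p where p: "P = ennreal p" "p \<ge> 0"
    using assms t u by (cases P; cases v) (auto simp: top_ennreal.rep_eq)
  obtain w where w: "v = ennreal w" "w \<ge> 0"
    using assms t u p by (cases v) (auto simp: top_ennreal.rep_eq)
  have "lam * w + p \<le> u + mu * t"
    using assms(1) t u p w by (simp add: enn2ereal_ennreal)
  then show ?thesis
    using t u p w assms by (simp add: ennreal_leI flip: ennreal_mult ennreal_plus)
qed

section \<open>Summation over the bidders\<close>

text \<open>Here \<open>h\<close> stands for the shares of the optimum, \<open>l\<close> for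
  equilibrium liquid welfare, \<open>p\<close> for payments, \<open>t\<close> for expected
  thresholds and \<open>w\<close> for total expected willingness to pay. The second alternative in
  \<open>alt\<close> is the saturated bidder.\<close>

lemma welfare_sum_bounds:
  fixes h l p t :: "'i \<Rightarrow> real" and lam mu k :: real
  assumes "finite N" "lam > 0" "mu \<ge> 0" "k \<ge> 0"
    and pos: "\<And>i. i \<in> N \<Longrightarrow> 0 \<le> l i \<and> 0 \<le> p i \<and> 0 \<le> t i"
    and alt: "\<And>i. i \<in> N \<Longrightarrow> lam * h i + p i \<le> l i + mu * t i \<or> (h i \<le> l i \<and> p i \<le> l i \<and> k = 1)"
    and tw: "sum t N \<le> w" and wl: "w \<le> sum l N"
  shows "lam * sum h N \<le> (mu + max 1 (lam * k)) * sum l N"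
    and "w = sum p N \<Longrightarrow> lam * sum h N \<le> max 1 (mu + lam * k) * sum l N"
proof -
  have L0: "sum l N \<ge> 0" using pos by (intro sum_nonneg) auto
  have mtw: "mu * sum t N \<le> mu * w" using tw assms by (intro mult_left_mono) auto
  have mwl: "mu * w \<le> mu * sum l N" using wl assms by (intro mult_left_mono) auto
  \<comment> \<open>Payments are dropped. An unsaturated bidder needs coefficient 1, a saturated one
    \<open>lam = lam * k\<close>; the maximum serves both.\<close>
  have "lam * h i \<le> max 1 (lam * k) * l i + mu * t i" if i: "i \<in> N" for i
  proof -
    have mt: "0 \<le> mu * t i" using pos[OF i] assms by simp
    have 1: "1 * l i \<le> max 1 (lam * k) * l i"
      using pos[OF i] by (intro mult_right_mono) auto
    have 2: "(lam * k) * l i \<le> max 1 (lam * k) * l i"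
      using pos[OF i] by (intro mult_right_mono) auto
    show ?thesis
      using alt[OF i]
    proof
      assume "lam * h i + p i \<le> l i + mu * t i"
      then show ?thesis using 1 pos[OF i] by linarith
    next
      assume a: "h i \<le> l i \<and> p i \<le> l i \<and> k = 1"
      then have "lam * h i \<le> lam * l i" using assms by (intro mult_left_mono) auto
      then show ?thesis using 2 mt a by simp
    qed
  qed
  then have "lam * sum h N \<le> max 1 (lam * k) * sum l N + mu * sum t N"
    by (simp add: sum_distrib_left sum_mono flip: sum.distrib)
  then show "lam * sum h N \<le> (mu + max 1 (lam * k)) * sum l N"
    using mtw mwl by (simp add: algebra_simps)
  assume w: "w = sum p N"
  show "lam * sum h N \<le> max 1 (mu + lam * k) * sum l N"
  proof (cases "mu \<ge> 1")
    case True
    \<comment> \<open>Payments keep full weight: for a saturated bidder \<open>l i - p i\<close> is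
      nonnegative, so the extra 1 in the coefficient covers the subtracted payment.\<close>
    have "lam * h i \<le> (1 + lam * k) * l i + mu * t i - p i" if i: "i \<in> N" for i
      using alt[OF i]
    proof
      assume a: "lam * h i + p i \<le> l i + mu * t i"
      have "0 \<le> lam * k * l i" using pos[OF i] assms by simp
      then show ?thesis using a by (simp add: algebra_simps)
    next
      assume a: "h i \<le> l i \<and> p i \<le> l i \<and> k = 1"
      then have "lam * h i \<le> lam * l i" using assms by (intro mult_left_mono) auto
      moreover have "0 \<le> mu * t i" using pos[OF i] assms by simp
      ultimately show ?thesis using a by (simp add: algebra_simps)
    qed
    then have "(\<Sum>i\<in>N. lam * h i) \<le> (\<Sum>i\<in>N. (1 + lam * k) * l i + mu * t i - p i)"
      by (rule sum_mono)
    then have "lam * sum h N \<le> (1 + lam * k) * sum l N + mu * sum t N - sum p N"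
      by (simp add: sum_distrib_left sum.distrib sum_subtractf)
    \<comment> \<open>As \<open>w\<close> is the total payment, weighted thresholds minus payments
      are at most \<open>(mu - 1) * w\<close>; charged to the welfare, this raises the coefficient
      \<open>1 + lam * k\<close> to \<open>mu + lam * k\<close>.\<close>
    moreover have "(mu - 1) * w \<le> (mu - 1) * sum l N"
      using wl True by (intro mult_left_mono) auto
    ultimately have "lam * sum h N \<le> (mu + lam * k) * sum l N"
      using mtw w by (simp add: algebra_simps)
    also have "\<dots> \<le> max 1 (mu + lam * k) * sum l N"
      using L0 by (intro mult_right_mono) auto
    finally show ?thesis .
  next
    case False
    \<comment> \<open>For \<open>mu < 1\<close> only the fraction \<open>mu\<close> of each payment
      is kept, just enough to cancel the thresholds after summing. A saturated bidder then costs
      \<open>lam + mu\<close>, an unsaturated one still 1.\<close>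
    have "lam * h i \<le> max 1 (mu + lam * k) * l i + mu * t i - mu * p i" if i: "i \<in> N" for i
    proof -
      have 1: "1 * l i \<le> max 1 (mu + lam * k) * l i"
        using pos[OF i] by (intro mult_right_mono) auto
      have 2: "(mu + lam * k) * l i \<le> max 1 (mu + lam * k) * l i"
        using pos[OF i] by (intro mult_right_mono) auto
      have mp: "mu * p i \<le> 1 * p i"
        using False pos[OF i] by (intro mult_right_mono) auto
      show ?thesis
        using alt[OF i]
      proof
        assume "lam * h i + p i \<le> l i + mu * t i"
        then show ?thesis using 1 mp by linarith
      next
        assume a: "h i \<le> l i \<and> p i \<le> l i \<and> k = 1"
        then have "lam * h i \<le> lam * l i" "mu * p i \<le> mu * l i"
          using assms by (auto intro: mult_left_mono)
        moreover have "0 \<le> mu * t i" using pos[OF i] assms by simp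
        ultimately show ?thesis using 2 a by (simp add: algebra_simps)
      qed
    qed
    then have "(\<Sum>i\<in>N. lam * h i) \<le> (\<Sum>i\<in>N. max 1 (mu + lam * k) * l i + mu * t i - mu * p i)"
      by (rule sum_mono)
    then have "lam * sum h N \<le> max 1 (mu + lam * k) * sum l N + mu * sum t N - mu * sum p N"
      by (simp add: sum_distrib_left sum.distrib sum_subtractf)
    then show ?thesis
      using mtw w by simp
  qed
qed

lemma ennreal_welfare_sum_bounds:
  fixes h l p t :: "'i \<Rightarrow> ennreal" and lam mu k :: real
  assumes "finite N" "lam > 0" "mu \<ge> 0" "k \<ge> 0"
    and fin: "\<And>i. i \<in> N \<Longrightarrow> l i < \<infinity>"
    and alt: "\<And>i. i \<in> N \<Longrightarrow>
      ennreal lam * h i + p i \<le> l i + ennreal mu * t i \<or> (h i \<le> l i \<and> p i \<le> l i \<and> k = 1)"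
    and tw: "sum t N \<le> w" and wl: "w \<le> sum l N"
  shows "sum h N \<le> ennreal ((mu + max 1 (lam * k)) / lam) * sum l N"
    and "w = sum p N \<Longrightarrow> sum h N \<le> ennreal (max 1 (mu + lam * k) / lam) * sum l N"
proof -
  have Lfin: "sum l N < \<infinity>" using fin assms(1) by simp
  have wfin: "w < \<infinity>" using wl Lfin by (rule le_less_trans)
  have tfin: "t i < \<infinity>" if "i \<in> N" for i
    using le_less_trans[OF tw wfin] that assms(1) by auto
  \<comment> \<open>Finiteness passes from \<open>l\<close> to \<open>w\<close>, then to
    \<open>t\<close>, and through \<open>alt\<close> to \<open>h\<close> and \<open>p\<close>, so
    everything can be read in the reals.\<close>
  have hpfin: "h i < \<infinity> \<and> p i < \<infinity>" if i: "i \<in> N" for i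
    using alt[OF i]
  proof
    assume "ennreal lam * h i + p i \<le> l i + ennreal mu * t i"
    also have "\<dots> < \<infinity>" using fin[OF i] tfin[OF i] by (simp add: ennreal_mult_less_top)
    finally show ?thesis
      using \<open>lam > 0\<close> by (auto simp: ennreal_mult_less_top ennreal_eq_0_iff)
  next
    assume "h i \<le> l i \<and> p i \<le> l i \<and> k = 1"
    then show ?thesis using fin[OF i] by (auto intro: le_less_trans)
  qed
  define h' l' p' t' w' where "h' = (\<lambda>i. enn2real (h i))" and "l' = (\<lambda>i. enn2real (l i))"
    and "p' = (\<lambda>i. enn2real (p i))" and "t' = (\<lambda>i. enn2real (t i))" and "w' = enn2real w"
  have nn: "h' i \<ge> 0" "l' i \<ge> 0" "p' i \<ge> 0" "t' i \<ge> 0" "w' \<ge> 0" for i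
    by (auto simp: h'_def l'_def p'_def t'_def w'_def)
  have eq: "h i = ennreal (h' i)" "l i = ennreal (l' i)" "p i = ennreal (p' i)"
    "t i = ennreal (t' i)" if "i \<in> N" for i
    using that hpfin fin tfin by (auto simp: h'_def l'_def p'_def t'_def)
  have weq: "w = ennreal w'" using wfin by (simp add: w'_def)
  have sums: "sum h N = ennreal (sum h' N)" "sum l N = ennreal (sum l' N)"
    "sum p N = ennreal (sum p' N)" "sum t N = ennreal (sum t' N)"
    using eq nn by (auto simp flip: sum_ennreal)
  have "\<And>i. i \<in> N \<Longrightarrow> lam * h' i + p' i \<le> l' i + mu * t' i \<or> (h' i \<le> l' i \<and> p' i \<le> l' i \<and> k = 1)"
    using alt eq nn assms(2,3) by (simp flip: ennreal_mult ennreal_plus)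
  moreover have "sum t' N \<le> w'" "w' \<le> sum l' N"
    using tw wl weq sums nn by (simp_all add: sum_nonneg)
  ultimately have b: "lam * sum h' N \<le> (mu + max 1 (lam * k)) * sum l' N"
    and a: "w' = sum p' N \<Longrightarrow> lam * sum h' N \<le> max 1 (mu + lam * k) * sum l' N"
    using welfare_sum_bounds[of N lam mu k l' p' t' h' w'] assms(1-4) nn by auto
  have scale: "ennreal H \<le> ennreal (c / lam) * ennreal L"
    if "lam * H \<le> c * L" "0 \<le> c" "0 \<le> L" for H c L
    using that \<open>lam > 0\<close> by (simp add: field_simps ennreal_leI flip: ennreal_mult)
  show "sum h N \<le> ennreal ((mu + max 1 (lam * k)) / lam) * sum l N"
    unfolding sums using b assms(3) nn by (intro scale) (auto simp: sum_nonneg)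
  assume "w = sum p N"
  then have "w' = sum p' N" using weq sums nn by (simp add: sum_nonneg)
  then show "sum h N \<le> ennreal (max 1 (mu + lam * k) / lam) * sum l N"
    unfolding sums using a nn by (intro scale) (auto simp: sum_nonneg)
qed

section \<open>Expected value and utility at equilibrium\<close>

lemma expected_valuation_finite:
  assumes valid: "valid_instance I" and mech: "mechanism_for M I"
    and A: "A \<in> distributions (profiles I)" and i: "i \<in> bidders I"
  shows "(\<integral>\<^sup>+ a. ennreal (valuation I i (alloc M a i)) \<partial>A) < \<infinity>"
proof -
  interpret prob_space A using A by (simp add: distributions_def)
  have sp: "space A = space (profiles I)"
    using A by (intro sets_eq_imp_space_eq) (simp add: distributions_def)
  \<comment> \<open>Finitely many allocations: the sum of all their valuations is a constant
    pointwise bound.\<close>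
  have "(\<integral>\<^sup>+ a. ennreal (valuation I i (alloc M a i)) \<partial>A)
      \<le> (\<integral>\<^sup>+ a. (\<Sum>x\<in>allocs I i. ennreal (valuation I i x)) \<partial>A)"
  proof (intro nn_integral_mono)
    fix a assume "a \<in> space A"
    then have "alloc M a i \<in> allocs I i"
      using mech valid i by (auto simp: sp mechanism_for_def valid_instance_def)
    moreover have "finite (allocs I i)"
      using valid i by (simp add: valid_instance_def)
    ultimately show "ennreal (valuation I i (alloc M a i)) \<le> (\<Sum>x\<in>allocs I i. ennreal (valuation I i x))"
      by (intro member_le_sum) auto
  qed
  also have "\<dots> < \<infinity>"
    using valid i emeasure_space_1 by (simp add: valid_instance_def)
  finally show ?thesis .
qed

lemma expected_utility_eq:
  assumes valid: "valid_instance I" and mech: "mechanism_for M I"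
    and A: "A \<in> distributions (profiles I)" and i: "i \<in> bidders I"
  shows "expect A (utility M I i) =
    enn2ereal (\<integral>\<^sup>+ a. ennreal (valuation I i (alloc M a i)) \<partial>A)
      - enn2ereal (\<integral>\<^sup>+ a. ennreal (pay M a i) \<partial>A)"
proof -
  have sets: "sets A = sets (profiles I)"
    using A by (simp add: distributions_def)
  then have sp: "space A = space (profiles I)"
    by (rule sets_eq_imp_space_eq)
  have "(\<lambda>a. alloc M a i) \<in> measurable (profiles I) (count_space (allocs I i))"
    using mech i by (simp add: mechanism_for_def)
  \<comment> \<open>Allocations carry the discrete sigma-algebra, so every valuation is
    measurable.\<close>
  from measurable_compose[OF this, of "valuation I i" borel]
  have v: "(\<lambda>a. valuation I i (alloc M a i)) \<in> borel_measurable A"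
    by (simp add: measurable_cong_sets[OF sets refl])
  have p: "(\<lambda>a. pay M a i) \<in> borel_measurable A"
    using mech i by (simp add: mechanism_for_def measurable_cong_sets[OF sets refl])
  have "valuation I i (alloc M a i) \<ge> 0" if "a \<in> space A" for a
    using that mech valid i by (auto simp: sp mechanism_for_def valid_instance_def dest!: bspec)
  moreover have "pay M a i \<ge> 0" if "a \<in> space A" for a
    using that mech i by (simp add: sp mechanism_for_def)
  ultimately show ?thesis
    unfolding utility_def
    using v p expected_valuation_finite[OF assms] by (intro expect_diff) auto
qed

section \<open>The price of anarchy bounds\<close>

theorem theorem3p1:
  fixes M :: "('a, 'x) mechanism"
    and \<I> :: "('a, 'x) auction_instance set"
    and lam mu :: real
  assumes "\<And>I. I \<in> \<I> \<Longrightarrow> valid_instance I \<and> mechanism_for M I"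
    and "lam > 0" and "mu \<ge> 0"
    and "\<And>I. I \<in> \<I> \<Longrightarrow> \<exists>T. threshold_functions I T \<and>
      (\<forall>A q. NOB_CCE M I A \<longrightarrow> optimal_profile I q \<longrightarrow>
         (\<Sum>i\<in>bidders I. expected_threshold I T i q A)
           \<le> (\<Sum>i\<in>bidders I. \<integral>\<^sup>+ a. willingness_at M I i a \<partial>A)) \<and>
      (\<exists>q. optimal_profile I q \<and> (\<forall>i\<in>bidders I. semi_smooth M I T q lam mu i))"
  shows "((\<forall>I\<in>\<I>. pay_your_bid M I) \<longrightarrow>
            CCE_POA_le M \<I> (max 1 (mu + lam * of_bool (\<I> \<noteq> budget_free_part \<I>)) / lam)) \<and>
         CCE_POA_le M \<I> ((mu + max 1 (lam * of_bool (\<I> \<noteq> budget_free_part \<I>))) / lam)"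
proof -
  define k :: real where "k = of_bool (\<I> \<noteq> budget_free_part \<I>)"
  have main: "OPT I \<le> ennreal ((mu + max 1 (lam * k)) / lam) * liquid_welfare M I A \<and>
      (pay_your_bid M I \<longrightarrow> OPT I \<le> ennreal (max 1 (mu + lam * k) / lam) * liquid_welfare M I A)"
    if I: "I \<in> \<I>" and A: "NOB_CCE M I A" for I A
  proof -
    have valid: "valid_instance I" and mech: "mechanism_for M I"
      using assms(1)[OF I] by auto
    \<comment> \<open>The threshold bound holds for every optimal profile, in particular for the one
      that witnesses semi-smoothness.\<close>
    obtain T q where
      TW: "(\<Sum>i\<in>bidders I. expected_threshold I T i q A)
           \<le> (\<Sum>i\<in>bidders I. \<integral>\<^sup>+ a. willingness_at M I i a \<partial>A)"
      and q: "optimal_profile I q" and sm: "\<And>i. i \<in> bidders I \<Longrightarrow> semi_smooth M I T q lam mu i"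
      using assms(4)[OF I] A by blast
    have cce: "is_CCE M I A"
      and nob: "(\<Sum>i\<in>bidders I. \<integral>\<^sup>+ a. willingness_at M I i a \<partial>A) \<le> liquid_welfare M I A"
      using A by (auto simp: NOB_CCE_def NOB_feasible_def)
    have distr: "A \<in> distributions (profiles I)"
      using cce by (simp add: is_CCE_def)
    have sp: "space A = space (profiles I)"
      using distr by (intro sets_eq_imp_space_eq) (simp add: distributions_def)
    define V where "V = (\<lambda>i. \<integral>\<^sup>+ a. ennreal (valuation I i (alloc M a i)) \<partial>A)"
    define P where "P = (\<lambda>i. \<integral>\<^sup>+ a. ennreal (pay M a i) \<partial>A)"
    define t where "t = (\<lambda>i. expected_threshold I T i q A)"
    define h where "h = (\<lambda>i. vhat I i (marginal_alloc i q))"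
    define l where "l = (\<lambda>i. min (V i) (budget I i))"
    define w where "w = (\<Sum>i\<in>bidders I. \<integral>\<^sup>+ a. willingness_at M I i a \<partial>A)"
    have finb: "finite (bidders I)" by (simp add: bidders_def)
    have LW: "liquid_welfare M I A = sum l (bidders I)"
      by (simp add: liquid_welfare_def l_def V_def)
    have OPT: "OPT I = sum h (bidders I)"
      using q by (simp add: optimal_profile_def allocation_welfare_def h_def)
    have Vfin: "V i < \<infinity>" if "i \<in> bidders I" for i
      unfolding V_def using expected_valuation_finite[OF valid mech distr that] .
    have lfin: "l i < \<infinity>" if "i \<in> bidders I" for i
      using Vfin[OF that] by (simp add: l_def min_less_iff_disj)
    have tw: "sum t (bidders I) \<le> w" and wl: "w \<le> sum l (bidders I)"
      using TW nob by (simp_all add: t_def w_def LW)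
    have "sum l (bidders I) < \<infinity>"
      using lfin finb by simp
    with order.trans[OF tw wl] have "sum t (bidders I) < \<infinity>"
      by (rule le_less_trans)
    then have tfin: "t i < \<infinity>" if "i \<in> bidders I" for i
      using that finb by auto
    have alt: "ennreal lam * h i + P i \<le> l i + ennreal mu * t i \<or> (h i \<le> l i \<and> P i \<le> l i \<and> k = 1)"
      if i: "i \<in> bidders I" for i
    \<comment> \<open>Unsaturated bidders have \<open>l i = V i\<close>, so the equilibrium
      condition against the smooth deviation bounds liquid welfare directly.\<close>
    proof (cases "V i \<le> budget I i")
      case True
      obtain D where D: "D \<in> deviations M I i (marginal_others I i A)"
        and "deviation_utility M I i D (marginal_others I i A)
          \<ge> ereal lam * enn2ereal (h i) - ereal mu * enn2ereal (t i)"
        using sm[OF i] A by (auto simp: semi_smooth_def h_def t_def)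
      moreover have "expect A (utility M I i) \<ge> deviation_utility M I i D (marginal_others I i A)"
        using cce i D by (auto simp: is_CCE_def)
      ultimately have "ereal lam * enn2ereal (h i) - ereal mu * enn2ereal (t i) \<le> enn2ereal (V i) - enn2ereal (P i)"
        using expected_utility_eq[OF valid mech distr i] by (simp add: V_def P_def)
      then show ?thesis
        using ereal_smoothness_to_ennreal[OF _ assms(2,3) tfin[OF i] Vfin[OF i]] True
        by (simp add: l_def min_absorb1)
    next
      case False
      then have l: "l i = budget I i" by (simp add: l_def)
      \<comment> \<open>A saturated bidder has a finite budget, so the instance is not budget-free
        and the indicator \<open>k\<close> is 1.\<close>
      have "budget I i \<noteq> \<infinity>" using False by auto
      then have "\<not> budget_free I" using i by (auto simp: budget_free_def)
      then have "k = 1" using I by (auto simp: k_def budget_free_part_def)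
      moreover have "h i \<le> l i" by (simp add: l h_def vhat_def)
      moreover have "P i \<le> l i"
        using cce i by (auto simp: l P_def is_CCE_def budget_feasible_def)
      ultimately show ?thesis by simp
    qed
    have k0: "k \<ge> 0" by (simp add: k_def)
    \<comment> \<open>Under pay-your-bid, willingness to pay and payment agree at every profile,
      which unlocks the sharper bound.\<close>
    have "w = sum P (bidders I)" if "pay_your_bid M I"
      unfolding w_def P_def using that
      by (intro sum.cong nn_integral_cong) (auto simp: pay_your_bid_def sp)
    then show ?thesis
      using ennreal_welfare_sum_bounds[of "bidders I" lam mu k l h P t w, OF finb assms(2,3) k0 lfin alt tw wl]
      by (simp add: LW OPT)
  qed
  show ?thesis
    using main by (auto simp: CCE_POA_le_def k_def)
qed

end
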